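(* Let $G$ be a connected graph. Then $G$ satisfies the Bottleneck Property (BP) if and only if there is a constant $\Delta''>0$, $\Delta''\in\mathbb{N}$, such that for every pair of vertices $a,b$ with $d(a,b)\ge 2\Delta''+2$ and any geodesic $[ab]$ joining them, there exists a vertex $c\in[ab]$ which is an $ab$-$N_{\Delta''}$-separator.
   Context: Every edge of the connected graph $G$ has length $1$, interior points of edges are points of $G$, and $d$ is the induced shortest-path (length) metric on $G$, making $G$ a geodesic metric space. A geodesic metric space $(X,d)$ satisfies the Bottleneck Property (BP) if there is a constant $\Delta>0$ such that, given any two distinct points $x,y\in X$ and any midpoint $z$, i.e. $d(x,z)=d(z,y)=\frac12 d(x,y)$, every $xy$-path (path in $X$ joining $x$ to $y$) intersects $N_\Delta(z)=\{w : d(z,w)\le\Delta\}$. For a set $S$ in $G$, $N_r(S):=\{x\in G : d(x,S)\le r\}$. Given two vertices $a,b$ and $r\in\mathbb{N}$, a set $S$ of vertices is an $ab$-$N_r$-separator if $a$ and $b$ are in different components of $G\setminus N_r(S)$; a vertex $c$ is an $ab$-$N_r$-separator if $\{c\}$ is. *)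

theory Defs
  imports "HOL-Analysis.Analysis"
begin

section \<open>Notions for metric spaces\<close>

context Metric_space
begin

definition is_geodesic :: "'a \<Rightarrow> 'a \<Rightarrow> (real \<Rightarrow> 'a) \<Rightarrow> bool" where
  "is_geodesic a b \<gamma> \<longleftrightarrow>
     \<gamma> ` {0..d a b} \<subseteq> M \<and> \<gamma> 0 = a \<and> \<gamma> (d a b) = b \<and>
     (\<forall>s\<in>{0..d a b}. \<forall>t\<in>{0..d a b}. d (\<gamma> s) (\<gamma> t) = \<bar>s - t\<bar>)"

definition bottleneck_property :: bool where
  "bottleneck_property \<longleftrightarrow>
     (\<exists>\<Delta>>0. \<forall>x\<in>M. \<forall>y\<in>M. x \<noteq> y \<longrightarrow>
        (\<forall>z\<in>M. d x z = d x y / 2 \<and> d z y = d x y / 2 \<longrightarrow>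
           (\<forall>g. pathin mtopology g \<and> g 0 = x \<and> g 1 = y \<longrightarrow>
                g ` {0..1} \<inter> mcball z \<Delta> \<noteq> {})))"

text \<open>The distance to the empty set is infinite; hence the side condition
  \<open>S \<noteq> {}\<close>, as \<open>Inf {}\<close> is unspecified on the reals.\<close>

definition closed_nbhd :: "real \<Rightarrow> 'a set \<Rightarrow> 'a set" where
  "closed_nbhd r S = {x \<in> M. S \<noteq> {} \<and> (INF s\<in>S. d x s) \<le> r}"

definition nbhd_separator :: "real \<Rightarrow> 'a \<Rightarrow> 'a \<Rightarrow> 'a set \<Rightarrow> bool" where
  "nbhd_separator r a b S \<longleftrightarrow>
     (\<exists>A B. A \<in> connected_components_of (subtopology mtopology (M - closed_nbhd r S)) \<and>
            B \<in> connected_components_of (subtopology mtopology (M - closed_nbhd r S)) \<and>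
            a \<in> A \<and> b \<in> B \<and> A \<noteq> B)"

end

section \<open>Connected graphs as length spaces\<close>

text \<open>Graphs are simple and undirected, possibly infinite and not locally finite.\<close>

locale connected_graph =
  fixes V :: "'a set" and E :: "'a set set"
  assumes edgeD: "\<And>e. e \<in> E \<Longrightarrow> \<exists>u\<in>V. \<exists>v\<in>V. u \<noteq> v \<and> e = {u, v}"
    and connected: "\<And>u v. u \<in> V \<Longrightarrow> v \<in> V \<Longrightarrow> (u, v) \<in> {(x, y). {x, y} \<in> E}\<^sup>*"

text \<open>A point of the geometric realization is given by its barycentric coordinates,
  a function \<open>'a \<Rightarrow> real\<close>: the vertex \<open>v\<close> is the unit mass at \<open>v\<close>, and the points
  of the closed edge \<open>{u, v}\<close> are the convex combinations of \<open>u\<close> and \<open>v\<close>. For points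
  \<open>x, y\<close> of a common edge \<open>{u, v}\<close> one has \<open>x u + x v = y u + y v = 1\<close>, so
  \<open>\<bar>x u - y u\<bar> = \<bar>x v - y v\<bar>\<close> is the length of the segment between them when
  the edge is identified with the unit interval.\<close>

definition vertex_pt :: "'a \<Rightarrow> 'a \<Rightarrow> real" where
  "vertex_pt v = (\<lambda>w. if w = v then 1 else 0)"

definition edge_pts :: "'a set \<Rightarrow> ('a \<Rightarrow> real) set" where
  "edge_pts e = {x. (\<forall>w. 0 \<le> x w) \<and> (\<forall>w. w \<notin> e \<longrightarrow> x w = 0) \<and> (\<Sum>w\<in>e. x w) = 1}"

definition graph_pts :: "'a set \<Rightarrow> 'a set set \<Rightarrow> ('a \<Rightarrow> real) set" where
  "graph_pts V E = vertex_pt ` V \<union> (\<Union>e\<in>E. edge_pts e)"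

text \<open>\<open>chain V E x y l\<close>: some finite concatenation of segments, each inside one closed
  edge, leads from \<open>x\<close> to \<open>y\<close> and has total length \<open>l\<close>.\<close>

inductive chain :: "'a set \<Rightarrow> 'a set set \<Rightarrow> ('a \<Rightarrow> real) \<Rightarrow> ('a \<Rightarrow> real) \<Rightarrow> real \<Rightarrow> bool"
  for V E where
  refl: "x \<in> graph_pts V E \<Longrightarrow> chain V E x x 0"
| step: "{u, v} \<in> E \<Longrightarrow> x \<in> edge_pts {u, v} \<Longrightarrow> y \<in> edge_pts {u, v} \<Longrightarrow> chain V E y z l
           \<Longrightarrow> chain V E x z (\<bar>x u - y u\<bar> + l)"

text \<open>The value \<open>0\<close> outside the graph only serves to meet the totality requirements of
  the locale \<^locale>\<open>Metric_space\<close>.\<close>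

definition graph_dist :: "'a set \<Rightarrow> 'a set set \<Rightarrow> ('a \<Rightarrow> real) \<Rightarrow> ('a \<Rightarrow> real) \<Rightarrow> real" where
  "graph_dist V E x y =
     (if x \<in> graph_pts V E \<and> y \<in> graph_pts V E then Inf {l. chain V E x y l} else 0)"

context connected_graph
begin

lemma edge_pts_pair:
  "u \<noteq> v \<Longrightarrow> x \<in> edge_pts {u, v} \<longleftrightarrow>
     (\<forall>w. 0 \<le> x w) \<and> (\<forall>w. w \<noteq> u \<and> w \<noteq> v \<longrightarrow> x w = 0) \<and> x u + x v = 1"
  by (auto simp: edge_pts_def)

lemma edge_neq: "{u, v} \<in> E \<Longrightarrow> u \<noteq> v"
  using edgeD by (metis doubleton_eq_iff)

lemma edge_in_V: "{u, v} \<in> E \<Longrightarrow> u \<in> V \<and> v \<in> V"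
  using edgeD by (metis doubleton_eq_iff)

lemma chain_in: "chain V E x y l \<Longrightarrow> x \<in> graph_pts V E \<and> y \<in> graph_pts V E"
  by (induction rule: chain.induct) (auto simp: graph_pts_def)

lemma edge_coord_diff:
  assumes "{u, v} \<in> E" "x \<in> edge_pts {u, v}" "y \<in> edge_pts {u, v}"
  shows "\<bar>x w - y w\<bar> \<le> \<bar>x u - y u\<bar>"
proof -
  have "u \<noteq> v" using assms(1) by (rule edge_neq)
  then have x: "w \<noteq> u \<and> w \<noteq> v \<longrightarrow> x w = 0" "x u + x v = 1"
    and y: "w \<noteq> u \<and> w \<noteq> v \<longrightarrow> y w = 0" "y u + y v = 1"
    using assms by (auto simp: edge_pts_pair)
  consider "w = u" | "w = v" | "w \<noteq> u \<and> w \<noteq> v" by blast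
  then show ?thesis using x y by cases auto
qed

lemma chain_coord_diff: "chain V E x y l \<Longrightarrow> \<bar>x w - y w\<bar> \<le> l"
proof (induction rule: chain.induct)
  case (step u v x y z l)
  then show ?case using edge_coord_diff[of u v x y w] by linarith
qed auto

lemma chain_nonneg: "chain V E x y l \<Longrightarrow> 0 \<le> l"
  using chain_coord_diff[of x y l undefined] by linarith

lemma chain_trans:
  "chain V E x y l \<Longrightarrow> chain V E y z m \<Longrightarrow> chain V E x z (l + m)"
proof (induction rule: chain.induct)
  case (step u v x y' y l)
  then have "chain V E x z (\<bar>x u - y' u\<bar> + (l + m))" by (intro chain.step) auto
  then show ?case by (simp add: add.assoc)
qed simp

lemma chain_single:
  assumes "{u, v} \<in> E" "x \<in> edge_pts {u, v}" "y \<in> edge_pts {u, v}"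
  shows "chain V E x y \<bar>x u - y u\<bar>"
proof -
  have "y \<in> graph_pts V E" using assms by (auto simp: graph_pts_def)
  then show ?thesis using chain.step[OF assms chain.refl] by simp
qed

lemma chain_sym: "chain V E x y l \<Longrightarrow> chain V E y x l"
proof (induction rule: chain.induct)
  case (step u v x y z l)
  have "chain V E y x \<bar>y u - x u\<bar>" using step.hyps by (intro chain_single)
  from chain_trans[OF step.IH this] show ?case by (simp add: add.commute abs_minus_commute)
qed (rule chain.refl)

lemma vertex_pt_edge: "{u, v} \<in> E \<Longrightarrow> vertex_pt u \<in> edge_pts {u, v}"
  using edge_neq[of u v] by (auto simp: edge_pts_pair vertex_pt_def)

lemma chain_vertices: "u \<in> V \<Longrightarrow> v \<in> V \<Longrightarrow> \<exists>l. chain V E (vertex_pt u) (vertex_pt v) l"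
proof -
  assume uv: "u \<in> V" "v \<in> V"
  from connected[OF uv] show ?thesis
  proof (induction rule: rtrancl_induct)
    case base
    have "vertex_pt u \<in> graph_pts V E" using uv by (simp add: graph_pts_def)
    then show ?case using chain.refl by blast
  next
    case (step y z)
    then have e: "{y, z} \<in> E" by simp
    have "vertex_pt z \<in> edge_pts {y, z}"
      using vertex_pt_edge[of z y] e by (simp add: insert_commute)
    from chain_single[OF e vertex_pt_edge[OF e] this] step.IH show ?case
      using chain_trans by blast
  qed
qed

lemma chain_to_vertex:
  assumes "x \<in> graph_pts V E" shows "\<exists>v\<in>V. \<exists>l. chain V E x (vertex_pt v) l"
proof (cases "x \<in> vertex_pt ` V")
  case True
  then show ?thesis using assms by (auto intro: chain.refl)
next
  case False
  then obtain e where e: "e \<in> E" "x \<in> edge_pts e" using assms by (auto simp: graph_pts_def)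
  then obtain u v where uv: "e = {u, v}" using edgeD by blast
  then show ?thesis
    using e chain_single[of u v x "vertex_pt u"] vertex_pt_edge[of u v] edge_in_V[of u v] by blast
qed

lemma chain_exists:
  assumes "x \<in> graph_pts V E" "y \<in> graph_pts V E" shows "\<exists>l. chain V E x y l"
  using chain_to_vertex[OF assms(1)] chain_to_vertex[OF assms(2)]
  by (meson chain_sym chain_trans chain_vertices)

lemma chain_bdd: "bdd_below {l. chain V E x y l}"
  using chain_nonneg by (intro bdd_belowI[of _ 0]) auto

lemma graph_dist_le: "chain V E x y l \<Longrightarrow> graph_dist V E x y \<le> l"
  using chain_in[of x y l] chain_bdd[of x y] by (auto simp: graph_dist_def intro!: cInf_lower)

lemma graph_dist_greatest:
  assumes "x \<in> graph_pts V E" "y \<in> graph_pts V E" "\<And>l. chain V E x y l \<Longrightarrow> c \<le> l"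
  shows "c \<le> graph_dist V E x y"
  using assms chain_exists[OF assms(1,2)] by (auto simp: graph_dist_def intro!: cInf_greatest)

sublocale Metric_space "graph_pts V E" "graph_dist V E"
proof
  fix x y z
  show "0 \<le> graph_dist V E x y"
    by (metis graph_dist_def graph_dist_greatest chain_nonneg order_refl)
  have "chain V E x y = chain V E y x" using chain_sym by blast
  then show "graph_dist V E x y = graph_dist V E y x" by (simp add: graph_dist_def)
  assume x: "x \<in> graph_pts V E" and y: "y \<in> graph_pts V E"
  show "graph_dist V E x y = 0 \<longleftrightarrow> x = y"
  proof
    assume 0: "graph_dist V E x y = 0"
    have "\<bar>x w - y w\<bar> \<le> graph_dist V E x y" for w
      using graph_dist_greatest[OF x y] chain_coord_diff by blast
    with 0 show "x = y" by (intro ext) simp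
  next
    assume "x = y"
    with x show "graph_dist V E x y = 0"
      using graph_dist_le[OF chain.refl[OF x]] graph_dist_greatest[OF x x chain_nonneg] by force
  qed
  assume z: "z \<in> graph_pts V E"
  have "graph_dist V E x z - l \<le> m" if "chain V E x y l" "chain V E y z m" for l m
    using graph_dist_le[OF chain_trans[OF that]] by linarith
  then have "graph_dist V E x z - l \<le> graph_dist V E y z" if "chain V E x y l" for l
    using graph_dist_greatest[OF y z] that by blast
  then have "graph_dist V E x z - graph_dist V E y z \<le> graph_dist V E x y"
    by (intro graph_dist_greatest[OF x y]) (simp add: diff_le_eq add.commute)
  then show "graph_dist V E x z \<le> graph_dist V E x y + graph_dist V E y z" by linarith
qed

end

end

theory Submission
  imports Defs
begin

text \<open>
  The graph enters the equivalence only through two facts: it is a geodesic space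
  (\<open>graph_geodesic_space\<close>), and every geodesic segment of length one contains a vertex
  (\<open>vertices_meet_unit_segments\<close>). The equivalence is therefore proved for an arbitrary
  geodesic space with a set \<open>P\<close> of points meeting every geodesic segment of length one.

  Suppose the bottleneck property holds with constant \<open>\<Delta>0\<close>, and let \<open>D \<ge> \<Delta>0 + 1\<close>. On a long
  geodesic from \<open>a\<close> to \<open>b\<close> choose \<open>c \<in> P\<close> within \<open>1/2\<close> of the midpoint. Every path from \<open>a\<close> to
  \<open>b\<close> meets the \<open>\<Delta>0\<close>-ball about the midpoint, hence the \<open>D\<close>-ball about \<open>c\<close>. So \<open>a\<close> and \<open>b\<close> lie
  in different path components of the complement of that closed ball, and these are its
  components because a geodesic space is locally path connected.

  Conversely, suppose that geodesics are separated with constant \<open>D\<close>, let \<open>z\<close> be a midpoint of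
  \<open>x\<close> and \<open>y\<close>, and suppose that a path from \<open>x\<close> to \<open>y\<close> misses the ball of radius \<open>D + 2\<close> about
  \<open>z\<close>. Take a geodesic from \<open>x\<close> to \<open>y\<close> through \<open>z\<close>, and on it points \<open>a, b \<in> P\<close> on the two sides
  of \<open>z\<close> at distance between \<open>D + 1\<close> and \<open>D + 2\<close> from it. Some \<open>c\<close> between them separates \<open>a\<close>
  from \<open>b\<close> by its \<open>D\<close>-ball. Since \<open>a\<close> and \<open>b\<close> are outside that ball, \<open>c\<close> is within \<open>2\<close> of \<open>z\<close>,
  so the path misses the ball; and the pieces of the geodesic from \<open>a\<close> back to \<open>x\<close> and from
  \<open>y\<close> back to \<open>b\<close> miss it as well, since they only move away from \<open>c\<close>. Thus \<open>a\<close> and \<open>b\<close> are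
  connected outside the ball, a contradiction.

  That the graph is geodesic needs an argument because it may have infinite degrees: the
  infimum over chains must be attained. Any chain can be replaced by one that is no longer and
  either stays in one edge or runs straight to an end of an edge, along a walk, and straight to
  the target (\<open>chain_shortcut\<close>). Below any bound only finitely many lengths of this form occur,
  so there is a shortest chain (\<open>chain_graph_dist\<close>), and its segments join to a geodesic.
\<close>

section \<open>Geodesics in metric spaces\<close>

context Metric_space
begin

lemma is_geodesic_in_space: "is_geodesic a b \<gamma> \<Longrightarrow> 0 \<le> t \<Longrightarrow> t \<le> d a b \<Longrightarrow> \<gamma> t \<in> M"
  unfolding is_geodesic_def by auto

lemma is_geodesic_dist:
  "is_geodesic a b \<gamma> \<Longrightarrow> 0 \<le> s \<Longrightarrow> s \<le> d a b \<Longrightarrow> 0 \<le> t \<Longrightarrow> t \<le> d a b \<Longrightarrow>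
     d (\<gamma> s) (\<gamma> t) = \<bar>s - t\<bar>"
  unfolding is_geodesic_def by auto

lemma is_geodesic_ends: "is_geodesic a b \<gamma> \<Longrightarrow> \<gamma> 0 = a \<and> \<gamma> (d a b) = b"
  unfolding is_geodesic_def by auto

text \<open>The two pieces cannot be closer to each other than along the joined curve: a shortcut between
  them would shorten the way from \<open>a\<close> to \<open>c\<close> below \<open>d a b + d b c\<close>.\<close>

lemma is_geodesic_join:
  assumes g: "is_geodesic a b \<gamma>" and h: "is_geodesic b c \<eta>" and eq: "d a c = d a b + d b c"
  shows "is_geodesic a c (\<lambda>t. if t \<le> d a b then \<gamma> t else \<eta> (t - d a b))"
    (is "is_geodesic a c ?\<theta>")
proof -
  note gM = is_geodesic_in_space[OF g] and hM = is_geodesic_in_space[OF h]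
  note gd = is_geodesic_dist[OF g] and hd = is_geodesic_dist[OF h]
  have ends: "\<gamma> 0 = a" "\<gamma> (d a b) = b" "\<eta> 0 = b" "\<eta> (d b c) = c"
    using is_geodesic_ends[OF g] is_geodesic_ends[OF h] by auto
  have abc: "a \<in> M" "b \<in> M" "c \<in> M"
    using gM[of 0] hM[of 0] hM[of "d b c"] ends by auto
  have mem: "?\<theta> t \<in> M" if "0 \<le> t" "t \<le> d a c" for t
    using that gM[of t] hM[of "t - d a b"] eq by auto
  have start: "?\<theta> 0 = a" using ends by simp
  have finish: "?\<theta> (d a c) = c"
  proof (cases "d b c = 0")
    case True
    then have "b = c" using abc by simp
    then show ?thesis using ends by simp
  next
    case False
    then have "d a b < d a c" using eq nonneg[of b c] by linarith
    then show ?thesis using ends eq by simp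
  qed
  have cross: "d (\<gamma> s) (\<eta> (t - d a b)) = t - s"
    if st: "0 \<le> s" "s \<le> d a b" "d a b < t" "t \<le> d a c" for s t
  proof -
    have t: "0 \<le> t - d a b" "t - d a b \<le> d b c" using st eq by auto
    note M = gM[OF st(1,2)] hM[OF t]
    have 1: "d a (\<gamma> s) = s" "d (\<gamma> s) b = d a b - s"
      using gd[of 0 s] gd[of s "d a b"] st unfolding ends by auto
    have 2: "d b (\<eta> (t - d a b)) = t - d a b" "d (\<eta> (t - d a b)) c = d b c - (t - d a b)"
      using hd[of 0 "t - d a b"] hd[of "t - d a b" "d b c"] t unfolding ends by auto
    have "d (\<gamma> s) (\<eta> (t - d a b)) \<le> t - s"
      using triangle[OF M(1) abc(2) M(2)] 1 2 by linarith
    moreover have "t - s \<le> d (\<gamma> s) (\<eta> (t - d a b))"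
      using triangle[OF abc(1) M(1) abc(3)] triangle[OF M abc(3)] 1 2 eq by linarith
    ultimately show ?thesis by linarith
  qed
  have "d (?\<theta> s) (?\<theta> t) = \<bar>s - t\<bar>"
    if "0 \<le> s" "s \<le> d a c" "0 \<le> t" "t \<le> d a c" for s t
  proof -
    consider "s \<le> d a b" "t \<le> d a b" | "s \<le> d a b" "d a b < t" | "d a b < s" "t \<le> d a b"
      | "d a b < s" "d a b < t" by linarith
    then show ?thesis
    proof cases
      case 1
      then show ?thesis using gd[of s t] that by simp
    next
      case 2
      then show ?thesis using cross[of s t] that by simp
    next
      case 3
      then show ?thesis using cross[of t s] that by (simp add: commute)
    next
      case 4
      then show ?thesis using hd[of "s - d a b" "t - d a b"] that eq by simp
    qed
  qed
  then show ?thesis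
    unfolding is_geodesic_def using mem start finish by (simp only: image_subset_iff) force
qed

lemma is_geodesic_subsegment:
  assumes "is_geodesic x y \<gamma>" "0 \<le> s" "s \<le> t" "t \<le> d x y"
  shows "is_geodesic (\<gamma> s) (\<gamma> t) (\<lambda>r. \<gamma> (s + r))"
proof -
  have "d (\<gamma> s) (\<gamma> t) = t - s" using assms is_geodesic_dist[OF assms(1), of s t] by auto
  then show ?thesis
    using assms is_geodesic_in_space[OF assms(1)] is_geodesic_dist[OF assms(1)]
    unfolding is_geodesic_def[of "\<gamma> s"] by (auto simp: image_subset_iff)
qed

lemma continuous_map_geodesic:
  assumes "is_geodesic a b \<gamma>"
  shows "continuous_map (top_of_set {0..d a b}) mtopology \<gamma>"
  unfolding continuous_map_to_metric
proof (intro ballI allI impI)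
  fix t and e :: real
  assume t: "t \<in> topspace (top_of_set {0..d a b})" and e: "e > 0"
  show "\<exists>U. openin (top_of_set {0..d a b}) U \<and> t \<in> U \<and> (\<forall>s\<in>U. \<gamma> s \<in> mball (\<gamma> t) e)"
    using t e is_geodesic_dist[OF assms] is_geodesic_in_space[OF assms]
    by (intro exI[of _ "{0..d a b} \<inter> ball t e"]) (auto simp: dist_real_def)
qed

lemma path_connectedin_geodesic:
  assumes "is_geodesic a b \<gamma>" "0 \<le> s" "t \<le> d a b"
  shows "path_connectedin mtopology (\<gamma> ` {s..t})"
proof (rule path_connectedin_continuous_map_image[OF continuous_map_geodesic[OF assms(1)]])
  show "path_connectedin (top_of_set {0..d a b}) {s..t}"
    using assms by (auto simp: path_connectedin_subtopology is_interval_path_connected)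
qed

definition geodesic_space :: bool where
  "geodesic_space \<longleftrightarrow> (\<forall>x\<in>M. \<forall>y\<in>M. \<exists>\<gamma>. is_geodesic x y \<gamma>)"

text \<open>A geodesic from the centre of a ball to one of its points stays in the ball, so balls are
  path connected.\<close>

lemma geodesic_space_locally_path_connected:
  assumes "geodesic_space"
  shows "locally_path_connected_space mtopology"
  unfolding locally_path_connected_space
proof (intro allI impI)
  fix U x assume U: "openin mtopology U \<and> x \<in> U"
  then obtain e where e: "e > 0" "mball x e \<subseteq> U" and x: "x \<in> M"
    by (meson openin_mtopology subsetD)
  let ?F = "{S. path_connectedin mtopology S \<and> x \<in> S \<and> S \<subseteq> mball x e}"
  have "y \<in> \<Union>?F" if y: "y \<in> mball x e" for y
  proof -
    obtain \<gamma> where g: "is_geodesic x y \<gamma>"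
      using assms x y unfolding geodesic_space_def by auto
    have "\<gamma> r \<in> mball x e" if "0 \<le> r" "r \<le> d x y" for r
      using is_geodesic_dist[OF g, of 0 r] is_geodesic_in_space[OF g, of r] is_geodesic_ends[OF g]
        x y that by auto
    moreover have "\<gamma> 0 \<in> \<gamma> ` {0..d x y}" "\<gamma> (d x y) \<in> \<gamma> ` {0..d x y}"
      by auto
    ultimately have "\<gamma> ` {0..d x y} \<in> ?F" "y \<in> \<gamma> ` {0..d x y}"
      using path_connectedin_geodesic[OF g, of 0 "d x y"] is_geodesic_ends[OF g] by auto
    then show ?thesis by blast
  qed
  then have "\<Union>?F = mball x e" by blast
  moreover have "path_connectedin mtopology (\<Union>?F)"
    by (rule path_connectedin_Union) auto
  ultimately have "path_connectedin mtopology (mball x e)" by simp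
  then show "\<exists>W. openin mtopology W \<and> path_connectedin mtopology W \<and> x \<in> W \<and> W \<subseteq> U"
    using e x by (intro exI[of _ "mball x e"]) auto
qed

section \<open>The bottleneck property of a geodesic space\<close>

lemma closed_nbhd_singleton: "c \<in> M \<Longrightarrow> closed_nbhd r {c} = mcball c r"
  unfolding closed_nbhd_def by (auto simp: commute)

text \<open>Membership of \<open>a\<close> and \<open>b\<close> in the complement is part of being separated: a point of the
  neighbourhood lies in no component.\<close>

lemma nbhd_separator_singleton_iff:
  assumes "c \<in> M"
  shows "nbhd_separator r a b {c} \<longleftrightarrow>
    a \<in> M - mcball c r \<and> b \<in> M - mcball c r \<and>
    \<not> connected_component_of (subtopology mtopology (M - mcball c r)) a b"
    (is "?L \<longleftrightarrow> ?R")
proof -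
  let ?X = "subtopology mtopology (M - mcball c r)"
  have top: "topspace ?X = M - mcball c r" by auto
  show ?thesis
  proof
    assume ?L
    then obtain A B where AB: "A \<in> connected_components_of ?X" "B \<in> connected_components_of ?X"
      "a \<in> A" "b \<in> B" "A \<noteq> B"
      unfolding nbhd_separator_def closed_nbhd_singleton[OF assms] by blast
    then have "A = connected_component_of_set ?X a" "B = connected_component_of_set ?X b"
      by (auto simp: connected_components_of_def dest: connected_component_of_eq[THEN iffD1])
         (metis connected_component_of_equiv)+
    then show ?R using AB top
      by (metis connected_component_in_topspace connected_component_of_equiv mem_Collect_eq)
  next
    assume R: ?R
    show ?L
      unfolding nbhd_separator_def closed_nbhd_singleton[OF assms]
    proof (intro exI conjI)
      show "connected_component_of_set ?X a \<in> connected_components_of ?X"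
        "connected_component_of_set ?X b \<in> connected_components_of ?X"
        using R top unfolding connected_components_of_def by blast+
      show "a \<in> connected_component_of_set ?X a" "b \<in> connected_component_of_set ?X b"
        using R top by (auto simp: connected_component_of_refl)
      then show "connected_component_of_set ?X a \<noteq> connected_component_of_set ?X b"
        using R by auto
    qed
  qed
qed

text \<open>These are the properties of the vertex set of a graph on which the argument rests.\<close>

definition meets_unit_segments :: "'a set \<Rightarrow> bool" where
  "meets_unit_segments P \<longleftrightarrow> P \<subseteq> M \<and>
     (\<forall>x\<in>M. \<forall>y\<in>M. \<forall>\<gamma> s. is_geodesic x y \<gamma> \<and> 0 \<le> s \<and> s + 1 \<le> d x y \<longrightarrow>
        (\<exists>r\<in>{s..s + 1}. \<gamma> r \<in> P))"

definition geodesics_separated :: "'a set \<Rightarrow> real \<Rightarrow> bool" where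
  "geodesics_separated P \<Delta> \<longleftrightarrow>
     (\<forall>a\<in>P. \<forall>b\<in>P. d a b \<ge> 2 * \<Delta> + 2 \<longrightarrow>
        (\<forall>\<gamma>. is_geodesic a b \<gamma> \<longrightarrow>
           (\<exists>c\<in>P. c \<in> \<gamma> ` {0..d a b} \<and> nbhd_separator \<Delta> a b {c})))"

lemma bottleneck_imp_geodesics_separated:
  assumes geo: "geodesic_space" and P: "meets_unit_segments P" and "bottleneck_property"
  shows "\<exists>\<Delta>::nat. \<Delta> > 0 \<and> geodesics_separated P (real \<Delta>)"
proof -
  obtain \<Delta>0 where "\<Delta>0 > 0" and bp: "\<forall>x\<in>M. \<forall>y\<in>M. x \<noteq> y \<longrightarrow>
      (\<forall>z\<in>M. d x z = d x y / 2 \<and> d z y = d x y / 2 \<longrightarrow>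
         (\<forall>g. pathin mtopology g \<and> g 0 = x \<and> g 1 = y \<longrightarrow> g ` {0..1} \<inter> mcball z \<Delta>0 \<noteq> {}))"
    using assms(3) unfolding bottleneck_property_def by (elim exE conjE)
  define D where "D = nat \<lceil>\<Delta>0\<rceil> + 1"
  have D: "\<Delta>0 + 1 \<le> real D" "D > 0" unfolding D_def by linarith+
  have "\<exists>c\<in>P. c \<in> \<gamma> ` {0..d a b} \<and> nbhd_separator (real D) a b {c}"
    if a: "a \<in> P" and b: "b \<in> P" and far: "d a b \<ge> 2 * real D + 2" and g: "is_geodesic a b \<gamma>"
    for a b \<gamma>
  proof -
    let ?L = "d a b"
    have ab: "a \<in> M" "b \<in> M" using a b P by (auto simp: meets_unit_segments_def)
    have "0 \<le> ?L/2 - 1/2" "?L/2 - 1/2 + 1 \<le> ?L" using far by auto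
    then have "\<exists>r\<in>{?L/2 - 1/2..?L/2 - 1/2 + 1}. \<gamma> r \<in> P"
      using P ab g unfolding meets_unit_segments_def by blast
    then obtain r where "?L/2 - 1/2 \<le> r" "r \<le> ?L/2 - 1/2 + 1" and c: "\<gamma> r \<in> P" by auto
    then have r: "\<bar>r - ?L/2\<bar> \<le> 1/2" by linarith
    have range: "0 \<le> r" "r \<le> ?L" "0 \<le> ?L/2" "?L/2 \<le> ?L" using r far by linarith+
    \<comment> \<open>The point \<open>\<gamma> r\<close> lies within \<open>1/2\<close> of the midpoint \<open>\<gamma> (?L/2)\<close>, so its distance from both
      ends is at least \<open>D + 1/2\<close>: the ends are outside its \<open>D\<close>-ball.\<close>
    let ?z = "\<gamma> (?L/2)" and ?X = "subtopology mtopology (M - mcball (\<gamma> r) (real D))"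
    have M: "?z \<in> M" "\<gamma> r \<in> M" using is_geodesic_in_space[OF g] range by auto
    have dz: "d (\<gamma> r) ?z \<le> 1/2" "d a ?z = ?L/2" "d ?z b = ?L/2"
      using is_geodesic_dist[OF g, of r "?L/2"] is_geodesic_dist[OF g, of 0 "?L/2"]
        is_geodesic_dist[OF g, of "?L/2" ?L] is_geodesic_ends[OF g] range r
      by auto
    have dc: "d a (\<gamma> r) = r" "d b (\<gamma> r) = ?L - r"
      using is_geodesic_dist[OF g, of 0 r] is_geodesic_dist[OF g, of ?L r] is_geodesic_ends[OF g] range
      by auto
    have "a \<noteq> b" using far ab D by auto
    have "\<not> connected_component_of ?X a b"
    proof
      assume conn: "connected_component_of ?X a b"
      have "openin mtopology (M - mcball (\<gamma> r) (real D))"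
        by (metis closedin_mcball openin_diff openin_topspace topspace_mtopology)
      then have "locally_path_connected_space ?X"
        using geodesic_space_locally_path_connected[OF geo] locally_path_connected_space_open_subset
        by blast
      from path_component_eq_connected_component_of[OF this, of a] have "path_component_of ?X a b"
        using conn by (metis mem_Collect_eq)
      then obtain g where path: "pathin ?X g" "g 0 = a" "g 1 = b"
        unfolding path_component_of_def by (elim exE conjE)
      have "pathin mtopology g"
        using path(1) unfolding pathin_subtopology by (rule conjunct1)
      have avoid: "g t \<notin> mcball (\<gamma> r) (real D)" if "t \<in> {0..1}" for t
        using path(1) that unfolding pathin_subtopology by blast
      have "g ` {0..1} \<inter> mcball ?z \<Delta>0 \<noteq> {}"
      proof (rule bp[rule_format, OF ab \<open>a \<noteq> b\<close> M(1)])
        show "d a ?z = ?L / 2 \<and> d ?z b = ?L / 2" using dz by simp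
        show "pathin mtopology g \<and> g 0 = a \<and> g 1 = b" using path \<open>pathin mtopology g\<close> by simp
      qed
      then obtain t where t: "t \<in> {0..1}" "g t \<in> mcball ?z \<Delta>0" by blast
      have "d (\<gamma> r) (g t) \<le> D"
        using triangle[of "\<gamma> r" ?z "g t"] t M dz D by auto
      then show False using avoid[OF t(1)] t M by auto
    qed
    then have "nbhd_separator (real D) a b {\<gamma> r}"
      unfolding nbhd_separator_singleton_iff[OF M(2)]
      using ab dc r far by (auto simp: commute)
    moreover have "\<gamma> r \<in> \<gamma> ` {0..?L}" using range by simp
    ultimately show ?thesis using c by blast
  qed
  then show ?thesis using D unfolding geodesics_separated_def by blast
qed

lemma geodesics_separated_imp_bottleneck:
  assumes geo: "geodesic_space" and P: "meets_unit_segments P"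
    and D: "D \<ge> 0" and sep: "geodesics_separated P D"
  shows "bottleneck_property"
  unfolding bottleneck_property_def
proof (intro exI[of _ "D + 2"] conjI ballI allI impI)
  show "D + 2 > 0" using D by simp
next
  fix x y z g
  assume xy: "x \<in> M" "y \<in> M" "x \<noteq> y" and z: "z \<in> M" "d x z = d x y / 2 \<and> d z y = d x y / 2"
    and g: "pathin mtopology g \<and> g 0 = x \<and> g 1 = y"
  let ?L = "d x y"
  show "g ` {0..1} \<inter> mcball z (D + 2) \<noteq> {}"
  proof (cases "?L / 2 \<le> D + 2")
    case True
    then have "g 0 \<in> mcball z (D + 2)" using g xy z by (auto simp: commute)
    then show ?thesis by force
  next
    case False
    then have L: "?L / 2 > D + 2" by simp
    \<comment> \<open>The midpoint is arbitrary, so the geodesic has to be chosen through it.\<close>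
    obtain \<gamma>1 \<gamma>2 where "is_geodesic x z \<gamma>1" "is_geodesic z y \<gamma>2"
      using geo xy z unfolding geodesic_space_def by blast
    from is_geodesic_join[OF this]
    obtain \<gamma> where \<gamma>: "is_geodesic x y \<gamma>" "\<gamma> (?L / 2) = \<gamma>1 (d x z)" 
      using z by fastforce
    then have mid: "\<gamma> (?L / 2) = z" using is_geodesic_ends[OF \<open>is_geodesic x z \<gamma>1\<close>] by simp
    have hit: "\<exists>r\<in>{s..s + 1}. \<gamma> r \<in> P" if "0 \<le> s" "s + 1 \<le> ?L" for s
      using P xy(1,2) \<gamma>(1) that unfolding meets_unit_segments_def by blast
    obtain s where s: "?L/2 - D - 2 \<le> s" "s \<le> ?L/2 - D - 1" "\<gamma> s \<in> P"
      using hit[of "?L/2 - D - 2"] L D by auto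
    obtain t where t: "?L/2 + D + 1 \<le> t" "t \<le> ?L/2 + D + 2" "\<gamma> t \<in> P"
      using hit[of "?L/2 + D + 1"] L D by auto
    have range: "0 \<le> s" "s \<le> t" "t \<le> ?L" using s t L D by auto
    note dist = is_geodesic_dist[OF \<gamma>(1)] and inM = is_geodesic_in_space[OF \<gamma>(1)]
    have dst: "d (\<gamma> s) (\<gamma> t) = t - s" using dist[of s t] range by auto
    obtain c where c: "c \<in> P" "c \<in> (\<lambda>r. \<gamma> (s + r)) ` {0..t - s}"
      and sepc: "nbhd_separator D (\<gamma> s) (\<gamma> t) {c}"
    proof -
      have "2 * D + 2 \<le> d (\<gamma> s) (\<gamma> t)" using dst s t by linarith
      from sep[unfolded geodesics_separated_def, rule_format,
          OF s(3) t(3) this is_geodesic_subsegment[OF \<gamma>(1) range]]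
      show ?thesis using that dst by auto
    qed
    obtain k where k: "c = \<gamma> k" "s \<le> k" "k \<le> t" using c by force
    have cM: "c \<in> M" using inM k range by auto
    let ?X = "subtopology mtopology (M - mcball c D)"
    have notin: "\<gamma> s \<in> M - mcball c D" "\<gamma> t \<in> M - mcball c D"
      and disc: "\<not> connected_component_of ?X (\<gamma> s) (\<gamma> t)"
      using sepc unfolding nbhd_separator_singleton_iff[OF cM] by auto
    have ks: "k - s > D" "t - k > D"
      using notin dist[of k s] dist[of k t] cM k range by auto
    \<comment> \<open>Beyond \<open>\<gamma> s\<close> and \<open>\<gamma> t\<close> the geodesic only moves away from \<open>c\<close>.\<close>
    have out: "\<gamma> r \<in> M - mcball c D" if "0 \<le> r" "r \<le> ?L" "r \<le> s \<or> t \<le> r" for r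
      using that inM[of r] dist[of k r] ks k range by auto
    \<comment> \<open>\<open>c\<close> is more than \<open>D\<close> from both \<open>\<gamma> s\<close> and \<open>\<gamma> t\<close>, which are at most \<open>D + 2\<close> from \<open>z\<close>.\<close>
    have "d z c \<le> 2"
      using dist[of "?L/2" k] mid k ks s t range L D by (auto simp: abs_le_iff)
    then have near: "mcball c D \<subseteq> mcball z (D + 2)"
      using triangle[of z c] z cM by fastforce
    show ?thesis
    proof
      assume miss: "g ` {0..1} \<inter> mcball z (D + 2) = {}"
      let ?A = "\<gamma> ` {0..s}" and ?G = "g ` {0..1}" and ?B = "\<gamma> ` {t..?L}"
      have cA: "connectedin mtopology ?A" and cB: "connectedin mtopology ?B"
        using path_connectedin_geodesic[OF \<gamma>(1)] range by (auto intro!: path_connectedin_imp_connectedin)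
      have cG: "connectedin mtopology ?G" using g connectedin_path_image by blast
      have x: "x \<in> ?A" "x \<in> ?G" and y: "y \<in> ?G" "y \<in> ?B"
        using is_geodesic_ends[OF \<gamma>(1)] g range by force+
      have "connectedin mtopology (?A \<union> ?G \<union> ?B)"
        using x y by (intro connectedin_Un cA cB cG) blast+
      moreover have "?A \<union> ?G \<union> ?B \<subseteq> M - mcball c D"
        using out range miss near connectedin_subset_topspace[OF cG] by auto
      ultimately have "connectedin ?X (?A \<union> ?G \<union> ?B)"
        by (simp add: connectedin_subtopology)
      moreover have "\<gamma> s \<in> ?A" "\<gamma> t \<in> ?B" using range by auto
      ultimately have "connected_component_of ?X (\<gamma> s) (\<gamma> t)"
        unfolding connected_component_of_def by blast
      then show False using disc by simp
    qed
  qed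
qed

end

section \<open>Graphs are geodesic spaces\<close>

context connected_graph
begin

lemma edge_coord_diff_other:
  assumes "{u, v} \<in> E" "x \<in> edge_pts {u, v}" "y \<in> edge_pts {u, v}"
  shows "\<bar>x v - y v\<bar> = \<bar>x u - y u\<bar>"
  using assms edge_neq[of u v] by (auto simp: edge_pts_pair abs_if)

lemma graph_dist_edge:
  assumes "{u, v} \<in> E" "x \<in> edge_pts {u, v}" "y \<in> edge_pts {u, v}"
  shows "graph_dist V E x y = \<bar>x u - y u\<bar>"
proof (rule antisym)
  show "graph_dist V E x y \<le> \<bar>x u - y u\<bar>" using chain_single[OF assms] by (rule graph_dist_le)
  show "\<bar>x u - y u\<bar> \<le> graph_dist V E x y"
    using assms chain_coord_diff by (intro graph_dist_greatest) (auto simp: graph_pts_def)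
qed

lemma graph_dist_coord:
  "x \<in> graph_pts V E \<Longrightarrow> y \<in> graph_pts V E \<Longrightarrow> \<bar>x w - y w\<bar> \<le> graph_dist V E x y"
  using graph_dist_greatest chain_coord_diff by blast

lemma is_geodesic_edge:
  assumes e: "{u, v} \<in> E" "x \<in> edge_pts {u, v}" "y \<in> edge_pts {u, v}"
  shows "\<exists>\<gamma>. is_geodesic x y \<gamma>"
proof -
  let ?D = "graph_dist V E x y"
  have D: "?D = \<bar>x u - y u\<bar>" by (rule graph_dist_edge[OF e])
  define \<gamma> where "\<gamma> t = (\<lambda>w. x w + t / ?D * (y w - x w))" for t
  have uv: "u \<noteq> v" using e(1) by (rule edge_neq)
  have on: "\<gamma> t \<in> edge_pts {u, v}" if t: "0 \<le> t" "t \<le> ?D" for t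
  proof -
    let ?c = "t / ?D"
    have c: "0 \<le> ?c" "?c \<le> 1" using t by (auto simp: divide_le_eq_1)
    have t_split: "p + c * (q - p) = (1 - c) * p + c * q" for c p q :: real
      by (simp add: algebra_simps)
    have conv: "\<gamma> t w = (1 - ?c) * x w + ?c * y w" for w
      unfolding \<gamma>_def by (rule t_split)
    have "\<gamma> t u + \<gamma> t v = (1 - ?c) * (x u + x v) + ?c * (y u + y v)"
      unfolding conv distrib_left by (simp only: ac_simps)
    then have "\<gamma> t u + \<gamma> t v = 1" using e uv by (simp add: edge_pts_pair)
    moreover have "0 \<le> \<gamma> t w" for w
      unfolding conv using c e uv
      by (intro add_nonneg_nonneg mult_nonneg_nonneg) (auto simp: edge_pts_pair)
    moreover have "\<gamma> t w = 0" if "w \<noteq> u \<and> w \<noteq> v" for w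
      unfolding conv using that e uv by (simp add: edge_pts_pair)
    ultimately show ?thesis using uv by (simp add: edge_pts_pair)
  qed
  have inG: "\<gamma> t \<in> graph_pts V E" if "0 \<le> t" "t \<le> ?D" for t
    using on[OF that] e by (auto simp: graph_pts_def)
  have xy: "x \<in> graph_pts V E" "y \<in> graph_pts V E" using e by (auto simp: graph_pts_def)
  have "\<gamma> ?D = y"
  proof (cases "?D = 0")
    case True
    then show ?thesis using xy by (simp add: \<gamma>_def)
  qed (simp add: \<gamma>_def)
  moreover have "graph_dist V E (\<gamma> s) (\<gamma> t) = \<bar>s - t\<bar>"
    if "0 \<le> s" "s \<le> ?D" "0 \<le> t" "t \<le> ?D" for s t
  proof -
    have "\<gamma> s u - \<gamma> t u = (s - t) / ?D * (y u - x u)"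
      by (simp add: \<gamma>_def algebra_simps diff_divide_distrib)
    then have "\<bar>\<gamma> s u - \<gamma> t u\<bar> = \<bar>s - t\<bar> / ?D * \<bar>x u - y u\<bar>"
      by (simp add: abs_mult abs_minus_commute)
    then have "\<bar>\<gamma> s u - \<gamma> t u\<bar> = \<bar>s - t\<bar>" using D that by (cases "?D = 0") auto
    then show ?thesis using graph_dist_edge[OF e(1) on on] that by simp
  qed
  ultimately have "is_geodesic x y \<gamma>"
    unfolding is_geodesic_def using inG by (auto simp: \<gamma>_def)
  then show ?thesis by blast
qed

text \<open>Two edges that share a point either coincide or meet in that point only, a common vertex:
  the support of the coordinates lies in both edges.\<close>

lemma edge_pts_two_edges:
  assumes "{u, v} \<in> E" "y \<in> edge_pts {u, v}" "{p, q} \<in> E" "y \<in> edge_pts {p, q}" "{u, v} \<noteq> {p, q}"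
  shows "\<exists>r\<in>{u, v} \<inter> {p, q}. y = vertex_pt r"
proof -
  have n: "u \<noteq> v" "p \<noteq> q" using assms edge_neq by auto
  have y: "\<And>w. 0 \<le> y w" "\<And>w. w \<notin> {u, v} \<inter> {p, q} \<Longrightarrow> y w = 0" "y u + y v = 1"
    using assms(2,4) n by (auto simp: edge_pts_pair)
  consider "y u = 0" | "y v = 0" | "y u \<noteq> 0" "y v \<noteq> 0" by blast
  then show ?thesis
  proof cases
    case 1
    then have "y v = 1" using y by simp
    moreover from this have "v \<in> {u, v} \<inter> {p, q}" using y(2)[of v] by auto
    moreover have "y w = 0" if "w \<noteq> v" for w using y(2)[of w] that 1 by auto
    ultimately show ?thesis by (intro bexI[of _ v]) (auto simp: vertex_pt_def)
  next
    case 2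
    then have "y u = 1" using y by simp
    moreover from this have "u \<in> {u, v} \<inter> {p, q}" using y(2)[of u] by auto
    moreover have "y w = 0" if "w \<noteq> u" for w using y(2)[of w] that 2 by auto
    ultimately show ?thesis by (intro bexI[of _ u]) (auto simp: vertex_pt_def)
  next
    case 3
    then have "u \<in> {p, q}" "v \<in> {p, q}" using y(2) by blast+
    then show ?thesis using n assms(5) by auto
  qed
qed

text \<open>The point \<open>x\<close> may have coordinate \<open>0\<close> at \<open>u\<close>; it is then the other end of the edge. With
  this convention \<open>1 - x u\<close> is always the length of a segment from \<open>x\<close> to \<open>u\<close>.\<close>

definition on_edge_at :: "('a \<Rightarrow> real) \<Rightarrow> 'a \<Rightarrow> bool" where
  "on_edge_at x u \<longleftrightarrow> (\<exists>v. {u, v} \<in> E \<and> x \<in> edge_pts {u, v})"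

abbreviation "adj \<equiv> {(x, y). {x, y} \<in> E}"

text \<open>Induction on the chain, prepending a segment from \<open>x\<close> to \<open>y\<close> in an edge \<open>{u, v}\<close> to a
  shortened chain from \<open>y\<close> to \<open>z\<close>. If that chain leaves \<open>y\<close> along \<open>{u, v}\<close> as well, the two
  segments are merged. If it leaves along another edge, then \<open>y\<close> is a vertex; so the segment
  from \<open>x\<close> already ends in a vertex, and a full edge traversed after it becomes a step of the
  walk.\<close>

lemma chain_shortcut:
  "chain V E x z l \<Longrightarrow>
     x = z \<or>
     (\<exists>p q. {p, q} \<in> E \<and> x \<in> edge_pts {p, q} \<and> z \<in> edge_pts {p, q} \<and> \<bar>x p - z p\<bar> \<le> l) \<or>
     (\<exists>u w n. on_edge_at x u \<and> on_edge_at z w \<and> (u, w) \<in> adj ^^ n \<and>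
        1 - x u + real n + (1 - z w) \<le> l)"
proof (induction rule: chain.induct)
  case (refl x)
  then show ?case by simp
next
  case (step u v x y z l)
  note e = step.hyps(1-3)
  have l: "0 \<le> l" using step.hyps(4) by (rule chain_nonneg)
  have at: "on_edge_at x r" "\<bar>x r - y r\<bar> = \<bar>x u - y u\<bar>" if "r \<in> {u, v}" for r
    using that e edge_coord_diff_other[OF e]
    by (auto simp: on_edge_at_def insert_commute)
  from step.IH show ?case
  proof (elim disjE exE conjE)
    assume "y = z"
    then show ?thesis using e l by (intro disjI2 disjI1 exI[of _ u] exI[of _ v]) auto
  next
    fix p q assume pq: "{p, q} \<in> E" "y \<in> edge_pts {p, q}" "z \<in> edge_pts {p, q}" "\<bar>y p - z p\<bar> \<le> l"
    have at': "on_edge_at z r" "\<bar>y r - z r\<bar> \<le> l" if "r \<in> {p, q}" for r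
      using that pq edge_coord_diff_other[OF pq(1-3)] by (auto simp: on_edge_at_def insert_commute)
    show ?thesis
    proof (cases "{u, v} = {p, q}")
      case True
      then have "p \<in> {u, v}" by auto
      then have "\<bar>x p - z p\<bar> \<le> \<bar>x u - y u\<bar> + l" using at(2)[of p] pq(4) by linarith
      then show ?thesis using True e pq by metis
    next
      case False
      then obtain r where r: "r \<in> {u, v}" "r \<in> {p, q}" "y = vertex_pt r"
        using edge_pts_two_edges[OF e(1,3) pq(1,2)] by auto
      have "y r = 1" using r by (simp add: vertex_pt_def)
      then have "1 - x r + real 0 + (1 - z r) \<le> \<bar>x u - y u\<bar> + l"
        using at(2)[OF r(1)] at'(2)[OF r(2)] by linarith
      then show ?thesis using at(1)[OF r(1)] at'(1)[OF r(2)] by (metis relpow_0_I)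
    qed
  next
    fix r w n
    assume H: "on_edge_at y r" "on_edge_at z w" "(r, w) \<in> adj ^^ n"
      "1 - y r + real n + (1 - z w) \<le> l"
    show ?thesis
    proof (cases "r \<in> {u, v}")
      case True
      have "1 - x r + real n + (1 - z w) \<le> \<bar>x u - y u\<bar> + l"
        using at(2)[OF True] H(4) by linarith
      then show ?thesis using at(1)[OF True] H by blast
    next
      case False
      obtain s where s: "{r, s} \<in> E" "y \<in> edge_pts {r, s}" using H(1) by (auto simp: on_edge_at_def)
      then obtain r' where "r' \<in> {u, v} \<inter> {r, s}" "y = vertex_pt r'"
        using edge_pts_two_edges[OF e(1,3) s] False by blast
      then have s': "s \<in> {u, v}" "y = vertex_pt s" using False by auto
      then have "y r = 0" "y s = 1" using edge_neq[OF s(1)] by (auto simp: vertex_pt_def)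
      then have "1 - x s + real (Suc n) + (1 - z w) \<le> \<bar>x u - y u\<bar> + l"
        using at(2)[OF s'(1)] H(4) by simp
      moreover have "(s, w) \<in> adj ^^ Suc n"
        using H(3) s(1) by (intro relpow_Suc_I2[of s r]) (auto simp: insert_commute)
      ultimately show ?thesis using at(1)[OF s'(1)] H by blast
    qed
  qed
qed

lemma chain_walk: "(u, w) \<in> adj ^^ n \<Longrightarrow> u \<in> V \<Longrightarrow> chain V E (vertex_pt u) (vertex_pt w) (real n)"
proof (induction n arbitrary: w)
  case 0
  then show ?case by (auto intro!: chain.refl simp: graph_pts_def)
next
  case (Suc n)
  then obtain y where y: "(u, y) \<in> adj ^^ n" "{y, w} \<in> E" by auto
  have w: "vertex_pt w \<in> edge_pts {y, w}" using vertex_pt_edge[of w y] y by (simp add: insert_commute)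
  have "chain V E (vertex_pt y) (vertex_pt w) 1"
    using chain_single[OF y(2) vertex_pt_edge[OF y(2)] w] edge_neq[OF y(2)] by (simp add: vertex_pt_def)
  from chain_trans[OF Suc.IH[OF y(1) Suc.prems(2)] this] show ?case by (simp add: add.commute)
qed

lemma graph_pt_cases:
  assumes "x \<in> graph_pts V E"
  obtains (vertex) v where "v \<in> V" "x = vertex_pt v"
  | (inner) u v where "{u, v} \<in> E" "x \<in> edge_pts {u, v}" "0 < x u" "0 < x v"
proof (cases "x \<in> vertex_pt ` V")
  case True
  then show ?thesis using vertex by blast
next
  case False
  then obtain e where "e \<in> E" "x \<in> edge_pts e" using assms by (auto simp: graph_pts_def)
  then obtain u v where e: "{u, v} \<in> E" "x \<in> edge_pts {u, v}" using edgeD by metis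
  have uv: "u \<noteq> v" using e(1) by (rule edge_neq)
  have x: "\<And>w. 0 \<le> x w" "\<And>w. w \<noteq> u \<Longrightarrow> w \<noteq> v \<Longrightarrow> x w = 0" "x u + x v = 1"
    using e uv by (auto simp: edge_pts_pair)
  have "x u \<noteq> 0"
  proof
    assume "x u = 0"
    then have "x w = vertex_pt v w" for w
      using x(2)[of w] x(3) by (cases "w = u"; cases "w = v") (auto simp: vertex_pt_def)
    then have "x = vertex_pt v" by blast
    then show False using False edge_in_V[OF e(1)] by blast
  qed
  moreover have "x v \<noteq> 0"
  proof
    assume "x v = 0"
    then have "x w = vertex_pt u w" for w
      using x(2)[of w] x(3) by (cases "w = u"; cases "w = v") (auto simp: vertex_pt_def)
    then have "x = vertex_pt u" by blast
    then show False using False edge_in_V[OF e(1)] by blast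
  qed
  ultimately show ?thesis using inner[OF e] x(1)[of u] x(1)[of v] by simp
qed

lemma graph_pt_coord_le_1:
  assumes "x \<in> graph_pts V E"
  shows "x w \<le> 1"
  using assms
proof (cases rule: graph_pt_cases)
  case (inner u v)
  then show ?thesis using edge_neq[of u v] by (cases "w = u"; cases "w = v") (auto simp: edge_pts_pair)
qed (simp_all add: vertex_pt_def)

lemma finite_range_graph_pt:
  assumes "x \<in> graph_pts V E"
  shows "finite (range x)"
  using assms
proof (cases rule: graph_pt_cases)
  case (vertex v)
  then have "range x \<subseteq> {0, 1}" by (auto simp: vertex_pt_def)
  then show ?thesis using finite_subset by blast
next
  case (inner u v)
  then have "range x \<subseteq> {0, x u, x v}" by (auto simp: edge_pts_def)
  then show ?thesis using finite_subset by blast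
qed

text \<open>The infimum defining the distance is a minimum. The lengths of shortened chains have the form
  \<open>\<bar>x u - z w\<bar>\<close> or \<open>1 - x u + n + (1 - z w)\<close>; the coordinates of \<open>x\<close> and \<open>z\<close> take finitely many
  values, so only finitely many such lengths are below a given bound.\<close>

lemma chain_graph_dist:
  assumes x: "x \<in> graph_pts V E" and z: "z \<in> graph_pts V E"
  shows "chain V E x z (graph_dist V E x z)"
proof -
  define T where "T = (\<lambda>(\<alpha>, \<beta>). \<bar>\<alpha> - \<beta>\<bar>) ` (range x \<times> range z) \<union>
    (\<lambda>(\<alpha>, \<beta>, n). 1 - \<alpha> + real n + (1 - \<beta>)) ` (range x \<times> range z \<times> UNIV)"
  have short: "\<exists>m\<in>T. m \<le> l \<and> chain V E x z m" if "chain V E x z l" for l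
    using chain_shortcut[OF that]
  proof (elim disjE exE conjE)
    assume "x = z"
    then show ?thesis
      using x chain.refl[OF x] chain_nonneg[OF that]
      by (intro bexI[of _ 0]) (auto simp: T_def image_iff)
  next
    fix p q assume "{p, q} \<in> E" "x \<in> edge_pts {p, q}" "z \<in> edge_pts {p, q}" "\<bar>x p - z p\<bar> \<le> l"
    then show ?thesis
      using chain_single[of p q x z] by (intro bexI[of _ "\<bar>x p - z p\<bar>"]) (auto simp: T_def)
  next
    fix u w n
    assume H: "on_edge_at x u" "on_edge_at z w" "(u, w) \<in> adj ^^ n" "1 - x u + real n + (1 - z w) \<le> l"
    have to_end: "chain V E y (vertex_pt r) (1 - y r) \<and> r \<in> V" if "on_edge_at y r" for y r
    proof -
      obtain s where s: "{r, s} \<in> E" "y \<in> edge_pts {r, s}" using \<open>on_edge_at y r\<close> by (auto simp: on_edge_at_def)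
      then have "\<bar>y r - vertex_pt r r\<bar> = 1 - y r"
        using edge_neq[OF s(1)] by (auto simp: edge_pts_pair vertex_pt_def) (smt (verit))
      then show ?thesis using chain_single[OF s vertex_pt_edge[OF s(1)]] edge_in_V[OF s(1)] by simp
    qed
    have "chain V E x z (1 - x u + real n + (1 - z w))"
      using to_end[OF H(1)] to_end[OF H(2)] chain_walk[OF H(3)] chain_trans chain_sym by blast
    moreover have "1 - x u + real n + (1 - z w) \<in> T"
      unfolding T_def by (rule UnI2, rule image_eqI[of _ _ "(x u, z w, n)"]) auto
    ultimately show ?thesis using H(4) by blast
  qed
  \<comment> \<open>Coordinates are at most \<open>1\<close>, so a length of the second form is at least \<open>n\<close>.\<close>
  have fin: "finite {m \<in> T. m \<le> K}" for K
  proof -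
    have "{m \<in> T. m \<le> K} \<subseteq> (\<lambda>(\<alpha>, \<beta>). \<bar>\<alpha> - \<beta>\<bar>) ` (range x \<times> range z) \<union>
      (\<lambda>(\<alpha>, \<beta>, n). 1 - \<alpha> + real n + (1 - \<beta>)) ` (range x \<times> range z \<times> {..nat \<lceil>K\<rceil>})"
    proof
      fix m assume "m \<in> {m \<in> T. m \<le> K}"
      then have m: "m \<in> T" "m \<le> K" by auto
      from m(1) show "m \<in> (\<lambda>(\<alpha>, \<beta>). \<bar>\<alpha> - \<beta>\<bar>) ` (range x \<times> range z) \<union>
        (\<lambda>(\<alpha>, \<beta>, n). 1 - \<alpha> + real n + (1 - \<beta>)) ` (range x \<times> range z \<times> {..nat \<lceil>K\<rceil>})"
        unfolding T_def
      proof
        assume "m \<in> (\<lambda>(\<alpha>, \<beta>, n). 1 - \<alpha> + real n + (1 - \<beta>)) ` (range x \<times> range z \<times> UNIV)"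
        then obtain u w n where m': "m = 1 - x u + real n + (1 - z w)"
          by (elim imageE SigmaE rangeE) (simp only: prod.case)
        then have "real n \<le> K"
          using m(2) graph_pt_coord_le_1[OF x, of u] graph_pt_coord_le_1[OF z, of w] by linarith
        then have "n \<le> nat \<lceil>K\<rceil>" by linarith
        then show ?thesis
          using m' by (intro UnI2 image_eqI[of _ _ "(x u, z w, n)"]) simp_all
      qed (rule UnI1)
    qed
    then show ?thesis
      by (rule finite_subset)
        (intro finite_UnI finite_imageI finite_cartesian_product finite_range_graph_pt x z finite_atMost)
  qed
  obtain l0 where l0: "chain V E x z l0" using chain_exists[OF x z] by blast
  let ?C = "{m \<in> T. m \<le> l0 \<and> chain V E x z m}"
  have finC: "finite ?C" using fin[of l0] by (rule finite_subset[rotated]) auto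
  have neC: "?C \<noteq> {}" using short[OF l0] by blast
  have MinC: "chain V E x z (Min ?C)" using Min_in[OF finC neC] by blast
  moreover have "Min ?C \<le> l" if "chain V E x z l" for l
  proof (cases "l \<le> l0")
    case True
    then obtain m where "m \<in> ?C" "m \<le> l" using short[OF \<open>chain V E x z l\<close>] by force
    then show ?thesis using Min_le[OF finC] by fastforce
  next
    case False
    then show ?thesis using Min_in[OF finC neC] by auto
  qed
  ultimately have "graph_dist V E x z = Min ?C"
    using graph_dist_le[OF MinC] graph_dist_greatest[OF x z] by (meson antisym)
  then show ?thesis using MinC by simp
qed

text \<open>By the triangle inequality every segment of a shortest chain, and every remainder of it, is
  itself shortest; so the geodesics along the segments can be joined.\<close>

lemma geodesic_of_shortest_chain:
  "chain V E x z l \<Longrightarrow> l = graph_dist V E x z \<Longrightarrow> \<exists>\<gamma>. is_geodesic x z \<gamma>"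
proof (induction rule: chain.induct)
  case (refl x)
  then have "is_geodesic x x (\<lambda>_. x)" by (auto simp: is_geodesic_def)
  then show ?case by blast
next
  case (step u v x y z l)
  have xyz: "x \<in> graph_pts V E" "y \<in> graph_pts V E" "z \<in> graph_pts V E"
    using step.hyps chain_in[of y z l] by (auto simp: graph_pts_def)
  have xy: "graph_dist V E x y = \<bar>x u - y u\<bar>" using step.hyps by (intro graph_dist_edge)
  have yz: "graph_dist V E y z \<le> l" using step.hyps by (intro graph_dist_le)
  have "l = graph_dist V E y z" "graph_dist V E x z = graph_dist V E x y + graph_dist V E y z"
    using triangle[OF xyz] xy yz step.prems by linarith+
  then show ?case
    using is_geodesic_edge[OF step.hyps(1-3)] step.IH is_geodesic_join by blast
qed

lemma graph_geodesic_space: "geodesic_space"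
  unfolding geodesic_space_def using chain_graph_dist geodesic_of_shortest_chain by blast

section \<open>Vertices on geodesics\<close>

lemma inner_pt_edge:
  assumes "x \<in> graph_pts V E" "u \<noteq> v" "0 < x u" "0 < x v"
  shows "{u, v} \<in> E" "x \<in> edge_pts {u, v}"
proof -
  have "{u, v} \<in> E \<and> x \<in> edge_pts {u, v}"
    using assms(1)
  proof (cases rule: graph_pt_cases)
    case (vertex w)
    then show ?thesis using assms by (auto simp: vertex_pt_def split: if_splits)
  next
    case (inner p q)
    then have "u \<in> {p, q}" "v \<in> {p, q}" using assms by (fastforce simp: edge_pts_def)+
    then have "{u, v} = {p, q}" using assms(2) by auto
    then show ?thesis using inner by simp
  qed
  then show "{u, v} \<in> E" "x \<in> edge_pts {u, v}" by auto
qed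

text \<open>Away from the vertices, the interior of an edge is described both by an open and by a closed
  condition on the coordinates. Hence a curve that avoids the vertices stays inside one edge.\<close>

lemma inner_pt_iff:
  assumes "x \<in> graph_pts V E" "x \<notin> vertex_pt ` V" "u \<noteq> v"
  shows "0 < x u \<and> 0 < x v \<longleftrightarrow> 1 \<le> x u + x v"
proof
  assume "0 < x u \<and> 0 < x v"
  then show "1 \<le> x u + x v" using inner_pt_edge[OF assms(1,3)] assms(3) by (simp add: edge_pts_pair)
next
  assume le: "1 \<le> x u + x v"
  from assms(1) show "0 < x u \<and> 0 < x v"
  proof (cases rule: graph_pt_cases)
    case (vertex w)
    then show ?thesis using assms by blast
  next
    case (inner p q)
    have "p \<noteq> q" using inner(1) by (rule edge_neq)
    then have "\<And>w. w \<noteq> p \<Longrightarrow> w \<noteq> q \<Longrightarrow> x w = 0" "x p + x q = 1"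
      using inner by (auto simp: edge_pts_pair)
    then show ?thesis using le inner(3,4) assms(3) \<open>p \<noteq> q\<close>
      by (cases "u = p"; cases "u = q"; cases "v = p"; cases "v = q"; force)
  qed
qed

text \<open>A geodesic segment of length one without vertices would run inside one edge, but two inner
  points of an edge have distance less than one.\<close>

lemma vertices_meet_unit_segments: "meets_unit_segments (vertex_pt ` V)"
  unfolding meets_unit_segments_def
proof (intro conjI ballI allI impI)
  show "vertex_pt ` V \<subseteq> graph_pts V E" by (auto simp: graph_pts_def)
next
  fix x y \<gamma> s
  assume "x \<in> graph_pts V E" "y \<in> graph_pts V E"
    and *: "is_geodesic x y \<gamma> \<and> 0 \<le> s \<and> s + 1 \<le> graph_dist V E x y"
  let ?I = "{s..s + 1}"
  have inG: "\<gamma> r \<in> graph_pts V E" if "r \<in> ?I" for r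
    using is_geodesic_in_space[of x y \<gamma> r] * that by auto
  have dist: "graph_dist V E (\<gamma> r) (\<gamma> t) = \<bar>r - t\<bar>" if "r \<in> ?I" "t \<in> ?I" for r t
    using is_geodesic_dist[of x y \<gamma> r t] * that by auto
  show "\<exists>r\<in>?I. \<gamma> r \<in> vertex_pt ` V"
  proof (rule ccontr)
    assume no: "\<not> (\<exists>r\<in>?I. \<gamma> r \<in> vertex_pt ` V)"
    have "s \<in> ?I" by simp
    from inG[OF this] obtain u v where uv: "{u, v} \<in> E" "0 < \<gamma> s u" "0 < \<gamma> s v"
      by (cases rule: graph_pt_cases) (use no \<open>s \<in> ?I\<close> in blast)+
    have ne: "u \<noteq> v" using uv(1) by (rule edge_neq)
    have iff: "0 < \<gamma> r u \<and> 0 < \<gamma> r v \<longleftrightarrow> 1 \<le> \<gamma> r u + \<gamma> r v" if "r \<in> ?I" for r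
      using inner_pt_iff[OF inG[OF that] _ ne] no that by blast
    \<comment> \<open>The coordinates are 1-Lipschitz along the geodesic.\<close>
    have cont: "continuous_on ?I (\<lambda>r. \<gamma> r w)" for w
    proof (rule continuous_on_iff[THEN iffD2], intro ballI allI impI)
      fix r and e :: real assume r: "r \<in> ?I" and e: "0 < e"
      have "dist (\<gamma> t w) (\<gamma> r w) \<le> dist t r" if "t \<in> ?I" for t
        using graph_dist_coord[OF inG[OF that] inG[OF r]] dist[OF that r] by (simp add: dist_real_def)
      then show "\<exists>k>0. \<forall>t\<in>?I. dist t r < k \<longrightarrow> dist (\<gamma> t w) (\<gamma> r w) < e"
        using e by (intro exI[of _ e]) fastforce
    qed
    let ?S = "{r \<in> ?I. 0 < \<gamma> r u \<and> 0 < \<gamma> r v}"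
    have "openin (top_of_set ?I) (?I \<inter> (\<lambda>r. min (\<gamma> r u) (\<gamma> r v)) -` {0<..})"
      by (intro continuous_openin_preimage_gen continuous_intros cont open_greaterThan)
    moreover have "?I \<inter> (\<lambda>r. min (\<gamma> r u) (\<gamma> r v)) -` {0<..} = ?S" by auto
    moreover have "closedin (top_of_set ?I) (?I \<inter> (\<lambda>r. \<gamma> r u + \<gamma> r v) -` {1..})"
      by (intro continuous_closedin_preimage continuous_intros cont closed_atLeast)
    moreover have "?I \<inter> (\<lambda>r. \<gamma> r u + \<gamma> r v) -` {1..} = ?S" using iff by blast
    ultimately have "?S = {} \<or> ?S = ?I"
      using connected_Icc[of s "s + 1"] unfolding connected_clopen by metis
    then have "?S = ?I" using uv by auto
    then have "s + 1 \<in> ?S" by auto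
    then have end_pos: "0 < \<gamma> (s + 1) u" "0 < \<gamma> (s + 1) v" by auto
    have E: "\<gamma> s \<in> edge_pts {u, v}" "\<gamma> (s + 1) \<in> edge_pts {u, v}"
      using inner_pt_edge[OF inG ne] uv end_pos by auto
    then have "\<bar>\<gamma> s u - \<gamma> (s + 1) u\<bar> = 1"
      using graph_dist_edge[OF uv(1) E] dist[of s "s + 1"] by simp
    moreover have "\<gamma> s u + \<gamma> s v = 1" "\<gamma> (s + 1) u + \<gamma> (s + 1) v = 1"
      using E ne by (auto simp: edge_pts_pair)
    ultimately show False using uv end_pos by linarith
  qed
qed

end

theorem theorem5p2:
  fixes V :: "'a set" and E :: "'a set set"
  assumes "connected_graph V E"
  shows "Metric_space.bottleneck_property (graph_pts V E) (graph_dist V E) \<longleftrightarrow>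
    (\<exists>\<Delta>::nat. \<Delta> > 0 \<and>
      (\<forall>a\<in>V. \<forall>b\<in>V. graph_dist V E (vertex_pt a) (vertex_pt b) \<ge> 2 * real \<Delta> + 2 \<longrightarrow>
        (\<forall>\<gamma>. Metric_space.is_geodesic (graph_pts V E) (graph_dist V E)
                 (vertex_pt a) (vertex_pt b) \<gamma> \<longrightarrow>
          (\<exists>c\<in>V. vertex_pt c \<in> \<gamma> ` {0..graph_dist V E (vertex_pt a) (vertex_pt b)} \<and>
             Metric_space.nbhd_separator (graph_pts V E) (graph_dist V E) (real \<Delta>)
               (vertex_pt a) (vertex_pt b) {vertex_pt c}))))"
proof -
  interpret connected_graph V E by (rule assms)
  have "bottleneck_property \<longleftrightarrow>
      (\<exists>\<Delta>::nat. \<Delta> > 0 \<and> geodesics_separated (vertex_pt ` V) (real \<Delta>))"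
    using bottleneck_imp_geodesics_separated[OF graph_geodesic_space vertices_meet_unit_segments]
      geodesics_separated_imp_bottleneck[OF graph_geodesic_space vertices_meet_unit_segments]
    by (meson of_nat_0_le_iff)
  then show ?thesis unfolding geodesics_separated_def by simp
qed

end
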